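(* Let $s\in(0,\tfrac18)$, $a=1-\sqrt{2s}\in(\tfrac12,1)$ and $\bar r(a)=\frac{1-2a+\sqrt{4a^2-4a+9}}{4}$. When the return cost is relatively low, meaning that $r\in[0,\bar r(a)]$ is low enough that the prominent firm earns a positive extra profit, $\pi_1-\pi_2>0$, an increase in the return cost $r$ leads to a decrease in the platform's advertising revenue from the position auction.
   Context: Two firms sell one product each at zero marginal cost. Consumers (unit mass) have match values $u_1,u_2$, i.i.d. uniform on $[0,1]$. Firm 1 denotes the firm in the prominent position (searched and bought first, at no search cost); searching and buying product 2 costs $s\in(0,1/8)$; returned units are fully refunded and cost the firm $r$ each. Prices are not observed before search, so search decisions depend on the actual $p_1$ and the expected (equilibrium) price $p_2$: with $a=1-\sqrt{2s}$, a consumer buys product 2 iff $u_1<a+p_1-p_2$. Given a candidate pair $(p_1,p_2)$, the deviation profits are as follows. If Firm 1 charges $p$ instead of $p_1$, $$\pi_1(p)=(p+r)\Big[1-(a+p-p_2)+\tfrac12(a^2-p_2^2)\Big]-r .$$ If Firm 2 charges $p$ instead of $p_2$ (consumers still expect $p_2$ when deciding whether to search), $$\pi_2(p)=(p+r)\Big[(a+p_1-p_2)\big(1-(a+p-p_2)\big)+\tfrac12(a-p_2)(a-p_2+2p_1)\Big]-r(a+p_1-p_2).$$ A pair $(p_1,p_2)$ of nonnegative prices is a price equilibrium if $p_1$ maximizes $\pi_1(\cdot)$ over $p\ge0$ and $p_2$ maximizes $\pi_2(\cdot)$ over $p\ge 0$. For each $r\in[0,1]$ there is exactly one price equilibrium,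 with $p_1,p_2\in[0,\frac{1-r}{2}]$; let $\pi_1,\pi_2$ be the resulting profits (prominent, non-prominent), as functions of $r$. The threshold $\bar r(a)$ is the return cost at which the equilibrium price $p_1$ reaches $0$; both prices are positive for $r<\bar r(a)$. Position auction: before price competition, the two firms bid for the prominent position; the higher bidder becomes prominent and pays the lower bid, the other pays nothing. With bids $b_1\geq b_2$ (the prominent firm bidding $b_1$), equilibrium of the auction requires $\pi_1-b_2\ge\pi_2$ and $\pi_2\ge\pi_1-b_1$, and the platform's revenue is $b_2\le \pi_1-\pi_2$. The advertising revenue considered is the maximal one, attained in the symmetric equilibrium ($\pi_1-b_2\ge\pi_2$ and $\pi_2\ge \pi_1-b_2$), namely $b_2=\pi_1-\pi_2$. *)

theory Defs
  imports "HOL-Analysis.Analysis"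
begin

text \<open>
  Here \<open>a = 1 - sqrt (2 * s)\<close> is the reservation cutoff and \<open>r\<close> the cost of a return; Firm 1 is the
  prominent firm. In \<open>profit1\<close> and \<open>profit2\<close> the last argument is the price actually charged,
  while \<open>p1\<close>, \<open>p2\<close> are the candidate prices. A Firm 2 deviation is not observed before search,
  so the mass \<open>a + p1 - p2\<close> of searchers depends on the candidate \<open>p2\<close> only.
\<close>

definition profit1 :: "real \<Rightarrow> real \<Rightarrow> real \<Rightarrow> real \<Rightarrow> real" where
  "profit1 a r p2 p = (p + r) * (1 - (a + p - p2) + (a\<^sup>2 - p2\<^sup>2) / 2) - r"

definition profit2 :: "real \<Rightarrow> real \<Rightarrow> real \<Rightarrow> real \<Rightarrow> real \<Rightarrow> real" where
  "profit2 a r p1 p2 p =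
     (p + r) * ((a + p1 - p2) * (1 - (a + p - p2)) + (a - p2) * (a - p2 + 2 * p1) / 2)
       - r * (a + p1 - p2)"

definition price_equilibrium :: "real \<Rightarrow> real \<Rightarrow> real \<times> real \<Rightarrow> bool" where
  "price_equilibrium a r = (\<lambda>(p1, p2).
     is_arg_max (profit1 a r p2) (\<lambda>p. 0 \<le> p) p1 \<and>
     is_arg_max (profit2 a r p1 p2) (\<lambda>p. 0 \<le> p) p2)"

text \<open>
  The description is meant for return costs at which the price equilibrium is unique, which is the
  case for \<open>1/2 < a < 1\<close> and \<open>0 \<le> r < 1\<close>.
\<close>

definition eq_prices :: "real \<Rightarrow> real \<Rightarrow> real \<times> real" where
  "eq_prices a r = (THE P. price_equilibrium a r P)"

definition prominent_profit :: "real \<Rightarrow> real \<Rightarrow> real" where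
  "prominent_profit a r = (case eq_prices a r of (p1, p2) \<Rightarrow> profit1 a r p2 p1)"

definition nonprominent_profit :: "real \<Rightarrow> real \<Rightarrow> real" where
  "nonprominent_profit a r = (case eq_prices a r of (p1, p2) \<Rightarrow> profit2 a r p1 p2 p2)"

text \<open>
  In the position auction \<open>b1\<close> is the winning bid and \<open>b2\<close> the losing one, which the winner pays;
  \<open>v1\<close> and \<open>v2\<close> are the subsequent profits in the prominent and the non-prominent position.
\<close>

definition auction_equilibrium :: "real \<Rightarrow> real \<Rightarrow> real \<Rightarrow> real \<Rightarrow> bool" where
  "auction_equilibrium v1 v2 b1 b2 \<longleftrightarrow> b1 \<ge> b2 \<and> v1 - b2 \<ge> v2 \<and> v2 \<ge> v1 - b1"

definition max_auction_revenue :: "real \<Rightarrow> real \<Rightarrow> real" where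
  "max_auction_revenue v1 v2 = (GREATEST b2. \<exists>b1. auction_equilibrium v1 v2 b1 b2)"

text \<open>The maximal revenue is the one of the symmetric equilibrium, in which both firms bid the same.\<close>

lemma symmetric_auction_equilibrium_iff:
  "auction_equilibrium v1 v2 b b \<longleftrightarrow> b = v1 - v2"
  by (auto simp: auction_equilibrium_def)

lemma max_auction_revenue_eq: "max_auction_revenue v1 v2 = v1 - v2"
  unfolding max_auction_revenue_def
  by (rule Greatest_equality)
     (use symmetric_auction_equilibrium_iff in blast, auto simp: auction_equilibrium_def)

definition advertising_revenue :: "real \<Rightarrow> real \<Rightarrow> real" where
  "advertising_revenue a r = max_auction_revenue (prominent_profit a r) (nonprominent_profit a r)"

definition rbar :: "real \<Rightarrow> real" where
  "rbar a = (1 - 2 * a + sqrt (4 * a\<^sup>2 - 4 * a + 9)) / 4"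

end

theory Submission
  imports Defs
begin

text \<open>
  In the coordinates \<open>x = a - p2\<close> and \<open>D = a + p1 - p2\<close> (the mass of searchers) the first-order
  conditions separate: eliminating \<open>r\<close> leaves a curve in the \<open>(x, D)\<close> plane, depending only on
  \<open>c = 1 - a\<close>, along which the return cost is an explicit and strictly increasing function of
  \<open>x\<close>; this gives existence and uniqueness of the price equilibrium. On the curve \<open>D\<close> changes
  by at most a small multiple of \<open>c\<close> times the change of \<open>x\<close>. Comparing the profit difference
  at two points of the curve, the direct effect of the return cost is at most \<open>- 2 c / 5\<close> per unit
  of \<open>x\<close>, while the change of \<open>D\<close> contributes at most \<open>c / 4\<close>, so the profit difference falls.
  At a corner \<open>p1 = 0\<close> where the first-order condition of Firm 1 is slack, it is not positive.
\<close>

section \<open>First-order conditions and the curve they define\<close>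

text \<open>
  The disjunct \<open>x = D\<close> is the corner \<open>p1 = 0\<close>. A corner \<open>p2 = 0\<close> needs \<open>r \<ge> 1 - a / 2\<close>,
  which exceeds \<open>rbar a\<close>.
\<close>

definition foc_curve :: "real \<Rightarrow> real \<Rightarrow> real \<Rightarrow> bool" where
  "foc_curve c x D \<longleftrightarrow> 0 \<le> x \<and> x \<le> D \<and> 0 < D \<and>
     (1 - D) * (4 * D + x\<^sup>2) \<le> 2 * c * D * (2 + x) \<and>
     (x = D \<or> (1 - D) * (4 * D + x\<^sup>2) = 2 * c * D * (2 + x))"

text \<open>The return cost obtained from Firm 2's first-order condition, with
  \<open>c = 1 - a\<close>.\<close>

definition curve_cost :: "real \<Rightarrow> real \<Rightarrow> real \<Rightarrow> real" where
  "curve_cost c x D = 2 * c - 1 + 2 * x - x\<^sup>2 / (2 * D)"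

text \<open>Kuhn-Tucker conditions on the half-line, read off from \<open>f (m + h) - f m = h *
  (\<beta> - 2 * \<gamma> * m - \<gamma> * h)\<close>. The sign of \<open>\<gamma>\<close> belongs
  to the equivalence because for Firm 2 it is \<open>a + p1 - p2\<close>, which a candidate pair
  could make negative.\<close>

lemma is_arg_max_quadratic_iff:
  fixes \<alpha> \<beta> \<gamma> m :: real
  assumes f: "\<And>p. f p = \<alpha> + \<beta> * p - \<gamma> * p\<^sup>2"
  shows "is_arg_max f (\<lambda>p. 0 \<le> p) m \<longleftrightarrow>
    0 \<le> \<gamma> \<and> 0 \<le> m \<and> \<beta> \<le> 2 * \<gamma> * m \<and> (m = 0 \<or> \<beta> = 2 * \<gamma> * m)"
proof
  assume "is_arg_max f (\<lambda>p. 0 \<le> p) m"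
  then have m: "0 \<le> m" and le: "\<And>p. 0 \<le> p \<Longrightarrow> f p \<le> f m"
    by (auto simp: is_arg_max_def not_less)
  have step: "h * (\<beta> - 2 * \<gamma> * m - \<gamma> * h) \<le> 0" if "0 \<le> m + h" for h
    using le[OF that] by (simp add: f power2_eq_square algebra_simps)
  define d where "d = \<beta> - 2 * \<gamma> * m"
  have pos: "d \<le> \<gamma> * h" if "0 < h" for h
    using step[of h] m that by (simp add: d_def mult_le_0_iff)
  have \<gamma>: "0 \<le> \<gamma>"
  proof (rule ccontr)
    assume "\<not> 0 \<le> \<gamma>"
    then have "0 < (\<bar>d\<bar> + 1) / (- \<gamma>)" "\<gamma> * ((\<bar>d\<bar> + 1) / (- \<gamma>)) = - (\<bar>d\<bar> + 1)"
      by (simp_all add: divide_pos_neg)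
    with pos have "d \<le> - (\<bar>d\<bar> + 1)" by metis
    then show False by linarith
  qed
  have d0: "d \<le> 0"
  proof (rule ccontr)
    assume "\<not> d \<le> 0"
    moreover have "d \<le> d * (\<gamma> / (2 * (\<gamma> + 1)))"
      using pos[of "d / (2 * (\<gamma> + 1))"] \<gamma> \<open>\<not> d \<le> 0\<close> by (simp add: field_simps)
    moreover have "\<gamma> / (2 * (\<gamma> + 1)) < 1" using \<gamma> by (simp add: field_simps)
    ultimately show False by (metis mult_less_cancel_left2 linorder_not_le)
  qed
  have "d = 0" if "m \<noteq> 0"
  proof (rule ccontr)
    assume "d \<noteq> 0"
    with d0 have d: "d < 0" by simp
    \<comment> \<open>A downward step: at most \<open>m\<close> to stay feasible, and short enough
      that \<open>\<gamma> * h < - d\<close>; the summand 1 covers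
      \<open>\<gamma> = 0\<close>.\<close>
    define h where "h = min m (- d / (2 * (\<gamma> + 1)))"
    have h: "0 < h" "h \<le> m" "h \<le> - d / (2 * (\<gamma> + 1))"
      using that m d \<gamma> by (auto simp: h_def field_simps)
    have "(- h) * (d + \<gamma> * h) \<le> 0"
      using step[of "- h"] h by (simp add: d_def)
    then have "0 \<le> d + \<gamma> * h" using h(1) by (simp add: mult_le_0_iff zero_le_mult_iff)
    moreover have "\<gamma> * h < - d"
    proof -
      have "2 * (\<gamma> + 1) * h \<le> - d" using h(3) \<gamma> by (simp add: field_simps)
      moreover have "0 \<le> \<gamma> * h" using \<gamma> h(1) by simp
      ultimately show ?thesis using h(1) by (simp add: algebra_simps)
    qed
    ultimately show False by linarith
  qed
  with \<gamma> m d0 show "0 \<le> \<gamma> \<and> 0 \<le> m \<and> \<beta> \<le> 2 * \<gamma> * m \<and> (m = 0 \<or> \<beta> = 2 * \<gamma> * m)"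
    by (auto simp: d_def)
next
  assume A: "0 \<le> \<gamma> \<and> 0 \<le> m \<and> \<beta> \<le> 2 * \<gamma> * m \<and> (m = 0 \<or> \<beta> = 2 * \<gamma> * m)"
  have "f p \<le> f m" if "0 \<le> p" for p
  proof -
    have "f m - f p = \<gamma> * (p - m)\<^sup>2 + (2 * \<gamma> * m - \<beta>) * (p - m)"
      by (simp add: f power2_eq_square algebra_simps)
    moreover have "0 \<le> (2 * \<gamma> * m - \<beta>) * (p - m)"
      using A that by (auto simp: mult_nonpos_nonneg)
    moreover have "0 \<le> \<gamma> * (p - m)\<^sup>2" using A by simp
    ultimately show ?thesis by linarith
  qed
  with A show "is_arg_max f (\<lambda>p. 0 \<le> p) m"
    by (auto simp: is_arg_max_def not_less)
qed

text \<open>Both deviation profits are quadratic in the firm's own price, with leading coefficients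
  \<open>- 1\<close> and \<open>- (a + p1 - p2)\<close>; hence the nonnegative mass of searchers
  among the conditions.\<close>

lemma price_equilibrium_iff_foc:
  "price_equilibrium a r (p1, p2) \<longleftrightarrow>
    0 \<le> p1 \<and> 1 - r - (1 - a) * (a - p2) - (a - p2)\<^sup>2 / 2 \<le> 2 * p1 \<and>
    (p1 = 0 \<or> 1 - r - (1 - a) * (a - p2) - (a - p2)\<^sup>2 / 2 = 2 * p1) \<and>
    0 \<le> a + p1 - p2 \<and> 0 \<le> p2 \<and>
    (a - p2) * (a - p2 + 2 * p1) / 2 \<le> (a + p1 - p2) * (p2 + r - (1 - a)) \<and>
    (p2 = 0 \<or> (a - p2) * (a - p2 + 2 * p1) / 2 = (a + p1 - p2) * (p2 + r - (1 - a)))"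
proof -
  have 1: "profit1 a r p2 p = r * (1 - a + p2 + (a\<^sup>2 - p2\<^sup>2) / 2) - r
      + (1 - r - (1 - a) * (a - p2) - (a - p2)\<^sup>2 / 2) * p - 1 * p\<^sup>2" for p
    by (simp add: profit1_def power2_eq_square field_simps)
  have 2: "profit2 a r p1 p2 p =
      r * ((a + p1 - p2) * (1 - a + p2) + (a - p2) * (a - p2 + 2 * p1) / 2) - r * (a + p1 - p2)
      + ((a + p1 - p2) * (1 - a + p2 - r) + (a - p2) * (a - p2 + 2 * p1) / 2) * p
      - (a + p1 - p2) * p\<^sup>2" for p
    by (simp add: profit2_def power2_eq_square field_simps)
  have e: "(a + p1 - p2) * (1 - a + p2 - r) - 2 * (a + p1 - p2) * p2
      = - ((a + p1 - p2) * (p2 + r - (1 - a)))"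
    by (simp add: algebra_simps)
  have shift: "(A + V \<le> B \<longleftrightarrow> V \<le> W) \<and> (A + V = B \<longleftrightarrow> V = W)"
    if "A - B = - W" for A B V W :: real
    using that by auto
  show ?thesis
    unfolding price_equilibrium_def prod.case is_arg_max_quadratic_iff[OF 1]
      is_arg_max_quadratic_iff[OF 2] mult_1_right
      shift[OF e, THEN conjunct1] shift[OF e, THEN conjunct2]
    using zero_le_one by blast
qed

text \<open>Below \<open>1 - a / 2\<close> the corner \<open>p2 = 0\<close> is impossible, so Firm
  2's condition is an equation that determines \<open>r\<close>; inserting it into Firm 1's
  condition and multiplying by \<open>2 * D\<close> gives the curve.\<close>

lemma price_equilibrium_iff_curve:
  assumes a: "1 / 2 < a" "a < 1" and r: "0 \<le> r" "r < 1 - a / 2"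
  shows "price_equilibrium a r (p1, p2) \<longleftrightarrow> 0 \<le> p2 \<and>
    foc_curve (1 - a) (a - p2) (a - p2 + p1) \<and>
    r = curve_cost (1 - a) (a - p2) (a - p2 + p1)"
proof -
  define x where "x = a - p2"
  define D where "D = a - p2 + p1"
  define F where "F = x * (2 * D - x) / 2"
  have p: "p1 = D - x" "p2 = a - x" by (simp_all add: x_def D_def)
  have h: "2 * D * (2 * (D - x) - (1 - r - (1 - a) * x - x\<^sup>2 / 2)) =
      2 * (1 - a) * D * (2 + x) - (1 - D) * (4 * D + x\<^sup>2)"
    if "r = curve_cost (1 - a) x D" "0 < D"
    using that by (simp add: curve_cost_def field_simps power2_eq_square)
  have cost: "F = D * ((a - x) + r - (1 - a)) \<longleftrightarrow> r = curve_cost (1 - a) x D" if "0 < D"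
    using that by (auto simp: F_def curve_cost_def field_simps power2_eq_square)
  have foc: "price_equilibrium a r (p1, p2) \<longleftrightarrow>
    x \<le> D \<and> 1 - r - (1 - a) * x - x\<^sup>2 / 2 \<le> 2 * (D - x) \<and>
    (x = D \<or> 1 - r - (1 - a) * x - x\<^sup>2 / 2 = 2 * (D - x)) \<and>
    0 \<le> D \<and> x \<le> a \<and> F \<le> D * ((a - x) + r - (1 - a)) \<and>
    (x = a \<or> F = D * ((a - x) + r - (1 - a)))"
    unfolding price_equilibrium_iff_foc p F_def
    by (auto simp: algebra_simps)
  have key: "0 \<le> x \<and> 0 < D \<and> F = D * ((a - x) + r - (1 - a))"
    if eq: "price_equilibrium a r (p1, p2)"
  proof -
    note fc = eq[unfolded foc]
    \<comment> \<open>Without searchers Firm 2's condition forces \<open>x = 0\<close>, and then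
      Firm 1's condition forces \<open>r \<ge> 1\<close>.\<close>
    have D: "0 < D"
    proof (rule ccontr)
      assume "\<not> 0 < D"
      with fc have D0: "D = 0" and x0: "x \<le> 0" by auto
      then have "F = - x\<^sup>2 / 2" by (simp add: F_def power2_eq_square)
      with fc D0 a have x: "x = 0" by auto
      with fc D0 r a show False by auto
    qed
    have x: "0 \<le> x"
    proof (rule ccontr)
      assume "\<not> 0 \<le> x"
      then have "x < 0" by simp
      then have "F < 0" using D by (simp add: F_def mult_less_0_iff)
      moreover have "0 < D * ((a - x) + r - (1 - a))"
        using D \<open>x < 0\<close> a r by (intro mult_pos_pos) auto
      moreover have "x \<noteq> a" using \<open>x < 0\<close> a by auto
      ultimately show False using fc by auto
    qed
    have "x \<noteq> a"
    proof
      assume xa: "x = a"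
      \<comment> \<open>The corner condition of Firm 2 at \<open>p2 = 0\<close> fails because
        \<open>r < 1 - a / 2\<close>.\<close>
      have "a * D / 2 \<le> F"
        using fc xa a by (simp add: F_def field_simps)
      also have "F \<le> D * (r - (1 - a))" using fc xa by auto
      also have "\<dots> < D * (a / 2)" using D r by (intro mult_strict_left_mono) auto
      finally show False by (simp add: algebra_simps)
    qed
    with D x fc show ?thesis by auto
  qed
  have "price_equilibrium a r (p1, p2) \<longleftrightarrow> x \<le> a \<and> foc_curve (1 - a) x D \<and> r = curve_cost (1 - a) x D"
    (is "?L \<longleftrightarrow> ?R")
  proof
    assume L: ?L
    note k = key[OF L]
    with cost have c: "r = curve_cost (1 - a) x D" by blast
    from k have D: "0 < 2 * D" by simp
    have "0 \<le> 2 * D * (2 * (D - x) - (1 - r - (1 - a) * x - x\<^sup>2 / 2))"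
      using L[unfolded foc] D by simp
    moreover have "x = D \<or> 1 - r - (1 - a) * x - x\<^sup>2 / 2 = 2 * (D - x)"
      using L unfolding foc by blast
    then have "x = D \<or> 0 = 2 * D * (2 * (D - x) - (1 - r - (1 - a) * x - x\<^sup>2 / 2))"
      by (metis diff_self mult_zero_right)
    moreover have "x \<le> D" "x \<le> a" using L unfolding foc by blast+
    ultimately show ?R
      using k c unfolding foc_curve_def h[OF c conjunct1[OF conjunct2[OF k]]]
      by (metis diff_ge_0_iff_ge right_minus_eq)
  next
    assume R: ?R
    then have D: "0 < D" and c: "r = curve_cost (1 - a) x D" by (auto simp: foc_curve_def)
    have "0 \<le> 2 * D * (2 * (D - x) - (1 - r - (1 - a) * x - x\<^sup>2 / 2))"
      using R unfolding h[OF c D] by (simp add: foc_curve_def)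
    then have "0 \<le> 2 * (D - x) - (1 - r - (1 - a) * x - x\<^sup>2 / 2)"
      using D by (simp add: zero_le_mult_iff)
    moreover have "x = D \<or> 0 = 2 * D * (2 * (D - x) - (1 - r - (1 - a) * x - x\<^sup>2 / 2))"
      using R unfolding h[OF c D] foc_curve_def by (metis right_minus_eq)
    then have "x = D \<or> 0 = 2 * (D - x) - (1 - r - (1 - a) * x - x\<^sup>2 / 2)"
      using D by simp
    then have "x = D \<or> 1 - r - (1 - a) * x - x\<^sup>2 / 2 = 2 * (D - x)" by linarith
    moreover have "x \<le> D" "x \<le> a" using R by (auto simp: foc_curve_def)
    ultimately show ?L
      unfolding foc using cost[OF D] c D by simp
  qed
  then show ?thesis by (auto simp: x_def D_def)
qed

section \<open>Monotonicity along the curve, existence and uniqueness of the equilibrium\<close>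

text \<open>Division by \<open>D\<close> makes the left side decreasing in \<open>D\<close>, the
  form in which two points of the curve are compared.\<close>

lemma curve_factor:
  fixes c x D :: real
  assumes "0 < D"
  shows "(1 - D) * (4 * D + x\<^sup>2) = 2 * c * D * (2 + x) \<longleftrightarrow>
      (1 - D) * (4 + x\<^sup>2 / D) = 2 * c * (2 + x)"
    and "(1 - D) * (4 * D + x\<^sup>2) \<le> 2 * c * D * (2 + x) \<longleftrightarrow>
      (1 - D) * (4 + x\<^sup>2 / D) \<le> 2 * c * (2 + x)"
proof -
  obtain q where "x\<^sup>2 / D = q" by simp
  with assms have q: "x\<^sup>2 / D = q" "x\<^sup>2 = D * q" by auto
  have "(1 - D) * (4 * D + x\<^sup>2) = D * ((1 - D) * (4 + x\<^sup>2 / D))"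
    unfolding q by (simp add: algebra_simps)
  moreover have "2 * c * D * (2 + x) = D * (2 * c * (2 + x))" by simp
  ultimately show "(1 - D) * (4 * D + x\<^sup>2) = 2 * c * D * (2 + x) \<longleftrightarrow>
      (1 - D) * (4 + x\<^sup>2 / D) = 2 * c * (2 + x)"
    and "(1 - D) * (4 * D + x\<^sup>2) \<le> 2 * c * D * (2 + x) \<longleftrightarrow>
      (1 - D) * (4 + x\<^sup>2 / D) \<le> 2 * c * (2 + x)"
    using assms by (simp_all only: mult_cancel_left mult_le_cancel_left_pos) simp
qed

text \<open>If \<open>E < D\<close>, the quadratic term \<open>(1 - D) * (x\<^sup>2 / D)\<close>
  does not fall on passing to \<open>y\<close>, \<open>E\<close>, so \<open>4 * (D - E)\<close> is
  at most the growth \<open>2 * c * (y - x)\<close> of the right side.\<close>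

lemma foc_curve_lower_lipschitz:
  assumes "foc_curve c x D" "foc_curve c y E" "x \<le> y" "0 < c"
  shows "D - E \<le> c / 2 * (y - x)"
proof (cases "D \<le> E \<or> x = D")
  case True
  then have "D \<le> E" using assms by (auto simp: foc_curve_def)
  moreover have "0 \<le> c / 2 * (y - x)" using assms by simp
  ultimately show ?thesis by linarith
next
  case False
  have D: "0 < D" "0 < E" "E < D" using assms False by (auto simp: foc_curve_def)
  have 1: "(1 - D) * (4 + x\<^sup>2 / D) = 2 * c * (2 + x)"
    using assms False D curve_factor(1)[OF D(1)] by (simp add: foc_curve_def)
  have 2: "(1 - E) * (4 + y\<^sup>2 / E) \<le> 2 * c * (2 + y)"
    using assms curve_factor(2)[OF D(2)] by (simp add: foc_curve_def)
  have x2: "x\<^sup>2 \<le> y\<^sup>2" "0 \<le> x\<^sup>2" using assms by (auto simp: foc_curve_def intro!: power_mono)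
  have E1: "E \<le> 1"
  proof (rule ccontr)
    assume "\<not> E \<le> 1"
    then have "(1 - D) * (4 + x\<^sup>2 / D) < 0"
      using D x2 by (intro mult_neg_pos add_pos_nonneg) auto
    moreover have "0 \<le> 2 * c * (2 + x)" using assms by (simp add: foc_curve_def)
    ultimately show False using 1 by simp
  qed
  have "(1 - D) * (x\<^sup>2 / D) = x\<^sup>2 / D - x\<^sup>2" using D by (simp add: field_simps)
  also have "\<dots> \<le> x\<^sup>2 / E - x\<^sup>2" using D x2 by (simp add: frac_le)
  also have "\<dots> = (1 - E) * (x\<^sup>2 / E)" using D by (simp add: field_simps)
  also have "\<dots> \<le> (1 - E) * (y\<^sup>2 / E)"
    using D E1 x2 by (intro mult_left_mono divide_right_mono) auto
  finally show ?thesis using 1 2 by (simp add: algebra_simps)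
qed

text \<open>The term \<open>2 * x\<close> grows at rate 2, while \<open>x\<^sup>2 / (2 * D)\<close>
  grows at rate at most 5/4: rate 1 through \<open>x\<close>, since
  \<open>x + y \<le> 2 * E\<close>, and 1/4 through a falling \<open>D\<close>, by the Lipschitz
  bound with \<open>c < 1\<close>.\<close>

lemma curve_cost_strict_mono:
  assumes "foc_curve c x D" "foc_curve c y E" "x < y" "0 < c" "c < 1"
  shows "curve_cost c x D < curve_cost c y E"
proof -
  have D: "0 < D" "0 < E" "0 \<le> x" "x \<le> D" "y \<le> E" "x \<le> E"
    using assms by (auto simp: foc_curve_def)
  have lip: "D - E \<le> c / 2 * (y - x)"
    using foc_curve_lower_lipschitz assms by force
  have "c / 2 * (y - x) \<le> 1 / 2 * (y - x)" using assms by (intro mult_right_mono) auto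
  then have DE: "D - E \<le> (y - x) / 2" using lip by simp
  have "(y\<^sup>2 - x\<^sup>2) / E = (y - x) * ((y + x) / E)"
    by (simp add: power2_eq_square field_simps)
  also have "\<dots> \<le> (y - x) * 2"
    using D assms by (intro mult_left_mono) (auto simp: field_simps)
  finally have 1: "(y\<^sup>2 - x\<^sup>2) / E \<le> 2 * (y - x)" by simp
  have 2: "x\<^sup>2 / E - x\<^sup>2 / D \<le> (y - x) / 2"
  proof -
    have "x\<^sup>2 / E - x\<^sup>2 / D = (x\<^sup>2 / (D * E)) * (D - E)"
      using D by (simp add: field_simps)
    also have "\<dots> \<le> (x\<^sup>2 / (D * E)) * ((y - x) / 2)"
      using D DE by (intro mult_left_mono) auto
    also have "\<dots> \<le> 1 * ((y - x) / 2)"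
      using D assms by (intro mult_right_mono) (auto simp: power2_eq_square intro: mult_mono)
    finally show ?thesis by simp
  qed
  have "y\<^sup>2 / E - x\<^sup>2 / D = (y\<^sup>2 - x\<^sup>2) / E + (x\<^sup>2 / E - x\<^sup>2 / D)"
    by (simp add: diff_divide_distrib)
  also have "\<dots> \<le> 2 * (y - x) + (y - x) / 2" using 1 2 by (rule add_mono)
  also have "\<dots> < 4 * (y - x)" using assms(3) by (simp add: field_simps)
  finally have "y\<^sup>2 / E - x\<^sup>2 / D < 4 * (y - x)" .
  then show ?thesis by (simp add: curve_cost_def)
qed

lemma foc_curve_cost_inj:
  assumes "foc_curve c x D" "foc_curve c y E" "0 < c" "c < 1"
    and "curve_cost c x D = curve_cost c y E"
  shows "x = y" "D = E"
proof -
  show xy: "x = y"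
    using curve_cost_strict_mono[of c x D y E] curve_cost_strict_mono[of c y E x D] assms
    by (cases x y rule: linorder_cases) auto
  show "D = E"
    using foc_curve_lower_lipschitz[of c x D y E] foc_curve_lower_lipschitz[of c y E x D] assms xy
    by auto
qed

text \<open>For fixed \<open>x\<close> the curve equation is quadratic in \<open>D\<close> with root
  product \<open>- x\<^sup>2 / 4\<close>. The larger of \<open>x\<close> and its nonnegative root is
  continuous in \<open>x\<close>, so the intermediate value theorem applies to the cost.\<close>

lemma foc_curve_cost_surj:
  assumes "0 < c" "c < 1 / 2" "0 \<le> r" "r \<le> (1 + c) / 2"
  obtains x D where "foc_curve c x D" "x \<le> 1 - c" "curve_cost c x D = r"
proof -
  \<comment> \<open>\<open>B\<close> is the linear coefficient of
    \<open>4 * D\<^sup>2 + B x * D - x\<^sup>2\<close>, \<open>S\<close> the root of its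
    discriminant, \<open>E\<close> the chosen \<open>D\<close>; the maximum with \<open>x\<close>
    covers the corner \<open>p1 = 0\<close>.\<close>
  define B where "B x = x\<^sup>2 - 4 + 2 * c * (2 + x)" for x
  define S where "S x = sqrt ((B x)\<^sup>2 + 16 * x\<^sup>2)" for x
  define E where "E x = max x ((S x - B x) / 8)" for x
  have SB: "\<bar>B x\<bar> \<le> S x" for x
    unfolding S_def by (rule real_le_rsqrt) simp
  have S2: "S x * S x = B x * B x + 16 * x\<^sup>2" for x
    by (simp add: S_def flip: power2_eq_square)
  have root: "(1 - D) * (4 * D + x\<^sup>2) - 2 * c * D * (2 + x) =
      - (4 * ((D - (S x - B x) / 8) * (D + (S x + B x) / 8)))" for x D
    using S2[of x] unfolding B_def by (simp add: field_simps power2_eq_square)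
  have pos: "0 < E x" if "0 \<le> x" for x
  proof (cases "x = 0")
    case True
    have "0 < S 0 - B 0" using SB[of 0] assms by (simp add: B_def)
    then show ?thesis unfolding E_def True by (simp add: less_max_iff_disj)
  next
    case False
    with that show ?thesis by (simp add: E_def less_max_iff_disj)
  qed
  have curve: "foc_curve c x (E x)" if "0 \<le> x" for x
  proof -
    have "0 \<le> E x + (S x + B x) / 8" "0 \<le> E x - (S x - B x) / 8"
      using SB[of x] pos[OF that] by (auto simp: E_def)
    then have "0 \<le> 4 * ((E x - (S x - B x) / 8) * (E x + (S x + B x) / 8))" by simp
    then have "(1 - E x) * (4 * E x + x\<^sup>2) - 2 * c * E x * (2 + x) \<le> 0"
      unfolding root neg_le_0_iff_le .
    moreover have "E x = x \<or> E x - (S x - B x) / 8 = 0"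
      unfolding E_def by linarith
    then have "E x = x \<or> (1 - E x) * (4 * E x + x\<^sup>2) - 2 * c * E x * (2 + x) = 0"
      unfolding root by auto
    ultimately show ?thesis
      using pos[OF that] that unfolding foc_curve_def by (auto simp: E_def)
  qed
  have "continuous_on {0..1 - c} E"
    unfolding E_def S_def B_def by (intro continuous_intros) auto
  then have cont: "continuous_on {0..1 - c} (\<lambda>x. curve_cost c x (E x))"
    unfolding curve_cost_def by (intro continuous_intros) (use pos in force)+
  \<comment> \<open>At \<open>x = 0\<close> the cost is \<open>2 * c - 1 < 0\<close>; at
    \<open>x = 1 - c\<close>, that is \<open>p2 = 0\<close>, it is at least
    \<open>(1 + c) / 2\<close>.\<close>
  have lo: "curve_cost c 0 (E 0) \<le> r" using assms by (simp add: curve_cost_def)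
  have "1 - c \<le> E (1 - c)" by (simp add: E_def)
  then have "(1 - c)\<^sup>2 / (2 * E (1 - c)) \<le> (1 - c)\<^sup>2 / (2 * (1 - c))"
    using assms by (intro divide_left_mono mult_pos_pos pos) auto
  also have "\<dots> = (1 - c) / 2" using assms by (simp add: power2_eq_square field_simps)
  finally have hi: "r \<le> curve_cost c (1 - c) (E (1 - c))"
    using assms unfolding curve_cost_def by (simp add: field_simps)
  obtain x where "0 \<le> x" "x \<le> 1 - c" "curve_cost c x (E x) = r"
    using IVT'[OF lo hi _ cont] assms by auto
  with curve that show thesis by blast
qed

text \<open>Surjectivity and injectivity of the cost along the curve justify the definite
  description in \<open>eq_prices\<close>.\<close>

lemma eq_prices_curve:
  assumes a: "1 / 2 < a" "a < 1" and r: "0 \<le> r" "r < 1 - a / 2"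
  obtains x D where "foc_curve (1 - a) x D" "x \<le> a" "r = curve_cost (1 - a) x D"
    "eq_prices a r = (D - x, a - x)"
proof -
  obtain x D where x: "foc_curve (1 - a) x D" "x \<le> 1 - (1 - a)" "curve_cost (1 - a) x D = r"
    using foc_curve_cost_surj[of "1 - a" r] assms by (auto simp: field_simps)
  have "eq_prices a r = (D - x, a - x)"
    unfolding eq_prices_def
  proof (rule the_equality)
    show "price_equilibrium a r (D - x, a - x)"
      unfolding price_equilibrium_iff_curve[OF assms] using x by simp
    fix P assume P: "price_equilibrium a r P"
    obtain p1 p2 where P12: "P = (p1, p2)" by fastforce
    have "foc_curve (1 - a) (a - p2) (a - p2 + p1)" "r = curve_cost (1 - a) (a - p2) (a - p2 + p1)"
      using P unfolding P12 price_equilibrium_iff_curve[OF assms] by auto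
    with foc_curve_cost_inj[OF this(1) x(1)] x a have "a - p2 = x" "a - p2 + p1 = D" by auto
    then show "P = (D - x, a - x)" unfolding P12 by auto
  qed
  with x that show thesis by auto
qed

text \<open>The square root is below 3. Hence all return costs up to \<open>rbar a\<close> lie in
  the range where equilibria are points of the curve.\<close>

lemma rbar_less: "1 / 2 < a \<Longrightarrow> a < 1 \<Longrightarrow> rbar a < 1 - a / 2"
proof -
  assume a: "1 / 2 < a" "a < 1"
  have "(3::real)\<^sup>2 - (4 * a\<^sup>2 - 4 * a + 9) = 4 * a * (1 - a)"
    by (simp add: power2_eq_square algebra_simps)
  also have "\<dots> > 0" using a by simp
  finally have "sqrt (4 * a\<^sup>2 - 4 * a + 9) < 3" by (intro real_less_lsqrt) auto
  then show ?thesis using a by (simp add: rbar_def)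
qed

section \<open>Bounds where Firm 1's first-order condition binds\<close>

text \<open>The first two bounds follow from \<open>(1 - D - c) * (4 * D + x\<^sup>2) = c * (2 * D *
  x - x\<^sup>2)\<close> and \<open>0 \<le> 2 * D * x - x\<^sup>2 \<le> D\<^sup>2 \<le> D\<close>.
  The expression in the other two is \<open>p2 + r\<close> at the equilibrium.\<close>

lemma foc_curve_interior_bounds:
  fixes c x D :: real
  assumes "0 \<le> x" "x \<le> D" "0 < D" "(1 - D) * (4 * D + x\<^sup>2) = 2 * c * D * (2 + x)" "0 < c"
  shows "c \<le> 1 - D" "1 - D \<le> 5 / 4 * c" "c \<le> c + x - x\<^sup>2 / (2 * D)"
    "c + x - x\<^sup>2 / (2 * D) \<le> (1 + c) / 2"
proof -
  have pos: "0 < 4 * D + x\<^sup>2" using assms by (simp add: add_pos_nonneg)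
  have x2: "x\<^sup>2 \<le> D * x" using assms by (simp add: power2_eq_square mult_right_mono)
  have e: "(1 - D - c) * (4 * D + x\<^sup>2) = c * (2 * (D * x) - x\<^sup>2)"
    unfolding left_diff_distrib[of "1 - D" c] assms(4) by (simp add: algebra_simps)
  have "0 \<le> D * x" using assms by simp
  with x2 have x2': "0 \<le> 2 * (D * x) - x\<^sup>2" by linarith
  with assms(5) have "0 \<le> c * (2 * (D * x) - x\<^sup>2)" by simp
  then show c: "c \<le> 1 - D" using pos unfolding e[symmetric] by (simp add: zero_le_mult_iff)
  have sq: "2 * (D * x) - x\<^sup>2 \<le> D\<^sup>2"
    using zero_le_power2[of "D - x"] by (simp add: power2_eq_square algebra_simps)
  also have "D\<^sup>2 \<le> D * 1"
    unfolding power2_eq_square using assms c by (intro mult_left_mono) auto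
  also have "\<dots> \<le> (4 * D + x\<^sup>2) / 4" by simp
  finally have "c * (2 * (D * x) - x\<^sup>2) \<le> c * ((4 * D + x\<^sup>2) / 4)"
    using assms by (intro mult_left_mono) auto
  then have "(1 - D - c) * (4 * D + x\<^sup>2) \<le> (c / 4) * (4 * D + x\<^sup>2)"
    unfolding e by simp
  then have "1 - D - c \<le> c / 4" using pos by (simp only: mult_le_cancel_right_pos)
  then show "1 - D \<le> 5 / 4 * c" by simp
  show "c \<le> c + x - x\<^sup>2 / (2 * D)"
    using x2' assms(3) by (simp add: field_simps)
  have "x - x\<^sup>2 / (2 * D) \<le> D / 2"
    using sq assms by (simp add: power2_eq_square field_simps)
  then show "c + x - x\<^sup>2 / (2 * D) \<le> (1 + c) / 2" using c by simp
qed

text \<open>If \<open>D < E\<close>, the quadratic term gains at most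
  \<open>5 / 2 * c * (y - x)\<close>, by the bound \<open>1 - E \<le> 5 / 4 * c\<close>, against
  \<open>2 * c * (y - x)\<close> on the right; a quarter of the surplus gives the constant
  1/8.\<close>

lemma foc_curve_upper_lipschitz:
  fixes c x y D E :: real
  assumes x: "0 \<le> x" "x \<le> D" "0 < D" "(1 - D) * (4 * D + x\<^sup>2) = 2 * c * D * (2 + x)"
    and y: "y \<le> E" "0 < E" "(1 - E) * (4 * E + y\<^sup>2) = 2 * c * E * (2 + y)"
    and c: "0 < c" and xy: "x \<le> y"
  shows "E - D \<le> c / 8 * (y - x)"
proof (cases "E \<le> D")
  case True
  moreover have "0 \<le> c / 8 * (y - x)" using c xy by simp
  ultimately show ?thesis by linarith
next
  case False
  have y0: "0 \<le> y" using x xy by simp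
  note E = foc_curve_interior_bounds[OF y0 y(1,2,3) c]
  have 1: "(1 - D) * (4 + x\<^sup>2 / D) = 2 * c * (2 + x)" using x curve_factor(1) by blast
  have 2: "(1 - E) * (4 + y\<^sup>2 / E) = 2 * c * (2 + y)" using y curve_factor(1) by blast
  have 3: "(1 - E) * (x\<^sup>2 / E) \<le> (1 - D) * (x\<^sup>2 / D)"
    using x False E c by (intro mult_mono frac_le) auto
  have "(1 - E) * (y\<^sup>2 / E) - (1 - E) * (x\<^sup>2 / E) = (1 - E) * ((y\<^sup>2 - x\<^sup>2) / E)"
    by (simp add: diff_divide_distrib right_diff_distrib)
  also have "\<dots> = (1 - E) * (y - x) * ((y + x) / E)"
    unfolding power2_eq_square square_diff_square_factored by simp
  also have "\<dots> \<le> (1 - E) * (y - x) * 2"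
    using y x xy E c by (intro mult_left_mono mult_nonneg_nonneg) (auto simp: field_simps)
  also have "\<dots> \<le> 5 / 4 * c * (y - x) * 2"
    using E xy by (intro mult_right_mono) auto
  finally have 4: "(1 - E) * (y\<^sup>2 / E) - (1 - E) * (x\<^sup>2 / E) \<le> 5 / 2 * (c * (y - x))"
    by simp
  have lin: "E - D \<le> g / 8"
    if "(1 - D) * 4 + p = k" "(1 - E) * 4 + q = k + 2 * g" "z \<le> p" "q - z \<le> 5 / 2 * g"
    for p q z k g :: real
    using that by (simp add: algebra_simps)
  have "E - D \<le> c * (y - x) / 8"
  proof (rule lin[OF _ _ 3 4])
    show "(1 - D) * 4 + (1 - D) * (x\<^sup>2 / D) = 2 * c * (2 + x)"
      using 1 by (simp only: distrib_left[of "1 - D"])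
    have "(1 - E) * 4 + (1 - E) * (y\<^sup>2 / E) = 2 * c * (2 + y)"
      using 2 by (simp only: distrib_left[of "1 - E"])
    also have "\<dots> = 2 * c * (2 + x) + 2 * (c * (y - x))" by (simp add: algebra_simps)
    finally show "(1 - E) * 4 + (1 - E) * (y\<^sup>2 / E) = 2 * c * (2 + x) + 2 * (c * (y - x))" .
  qed
  then show ?thesis by simp
qed

section \<open>The profit difference along the curve\<close>

text \<open>
  Here \<open>Q = p2 + r\<close>. By the first-order conditions the brackets in \<open>profit1\<close> and \<open>profit2\<close> equal
  \<open>p1 + r = Q + c - (1 - D)\<close> and \<open>D * Q\<close>.
\<close>

definition curve_gap :: "real \<Rightarrow> real \<Rightarrow> real \<Rightarrow> real" where
  "curve_gap c x D = (let Q = c + x - x\<^sup>2 / (2 * D) in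
     2 * Q * (c - (1 - D)) + (c - (1 - D))\<^sup>2 + (1 - D) * (Q\<^sup>2 - curve_cost c x D))"

text \<open>With both conditions binding the profits are \<open>(p1 + r)\<^sup>2 - r\<close> and
  \<open>D * (p2 + r)\<^sup>2 - r * D\<close>.\<close>

lemma profit_gap_interior:
  assumes D: "0 < D" "(1 - D) * (4 * D + x\<^sup>2) = 2 * (1 - a) * D * (2 + x)"
    and r: "r = curve_cost (1 - a) x D"
  shows "profit1 a r (a - x) (D - x) - profit2 a r (D - x) (a - x) (a - x) = curve_gap (1 - a) x D"
proof -
  define w where "w = x\<^sup>2 / (2 * D)"
  have w: "x\<^sup>2 = 2 * D * w" using D by (simp add: w_def)
  have r': "r = 1 - 2 * a + 2 * x - w" by (simp add: r curve_cost_def w_def)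
  have "(1 - D) * (4 * D + x\<^sup>2) = D * ((1 - D) * (4 + 2 * w))"
    unfolding w by (simp add: algebra_simps)
  with D have e: "(1 - D) * (4 + 2 * w) = 2 * (1 - a) * (2 + x)" by simp
  have "1 - (a + (D - x) - (a - x)) + (a\<^sup>2 - (a - x)\<^sup>2) / 2 = 1 - D + a * x - x\<^sup>2 / 2"
    by (simp add: power2_eq_square field_simps)
  also have "\<dots> = (D - x) + r" using e unfolding w r' by (simp add: field_simps)
  finally have b1: "1 - (a + (D - x) - (a - x)) + (a\<^sup>2 - (a - x)\<^sup>2) / 2 = (D - x) + r" .
  have b2: "(a + (D - x) - (a - x)) * (1 - (a + (a - x) - (a - x)))
      + (a - (a - x)) * (a - (a - x) + 2 * (D - x)) / 2 = D * ((a - x) + r)"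
  proof -
    have "?thesis \<longleftrightarrow> D * (1 - a) + D * x - x\<^sup>2 / 2 = D * ((a - x) + r)"
      by (simp add: power2_eq_square field_simps)
    then show ?thesis unfolding w r' by (simp add: field_simps)
  qed
  have "profit1 a r (a - x) (D - x) - profit2 a r (D - x) (a - x) (a - x)
      = ((D - x) + r)\<^sup>2 - r - (((a - x) + r) * (D * ((a - x) + r)) - r * D)"
    unfolding profit1_def profit2_def b1 b2 by (simp add: power2_eq_square)
  also have "\<dots> = curve_gap (1 - a) x D"
    unfolding curve_gap_def Let_def r[symmetric] w_def[symmetric] unfolding r'
    by (simp add: power2_eq_square algebra_simps)
  finally show ?thesis .
qed

text \<open>The difference splits exactly: first \<open>Q\<close> and the cost move at fixed
  \<open>t = 1 - D\<close>, then \<open>t\<close> moves to \<open>v = 1 - E\<close>. With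
  \<open>u = y - x\<close> the first part is at most \<open>- (2 / 5) * (t * u)\<close>, the second
  at most \<open>c * u / 4\<close>, and \<open>c \<le> t\<close>.\<close>

lemma curve_gap_strict_antimono:
  assumes x: "0 \<le> x" "x \<le> D" "0 < D" "(1 - D) * (4 * D + x\<^sup>2) = 2 * c * D * (2 + x)"
    and y: "y \<le> E" "0 < E" "(1 - E) * (4 * E + y\<^sup>2) = 2 * c * E * (2 + y)"
    and c: "0 < c" "c < 1 / 2" and xy: "x < y"
    and r: "0 \<le> curve_cost c y E" "curve_cost c y E \<le> 1"
  shows "curve_gap c y E < curve_gap c x D"
proof -
  define u where "u = y - x"
  define Q where "Q = c + x - x\<^sup>2 / (2 * D)"
  define R where "R = c + y - y\<^sup>2 / (2 * E)"
  define t where "t = 1 - D"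
  define v where "v = 1 - E"
  have u: "0 < u" using xy by (simp add: u_def)
  have y0: "0 \<le> y" using x xy by simp
  have "foc_curve c x D" "foc_curve c y E" using x y y0 by (auto simp: foc_curve_def)
  from foc_curve_lower_lipschitz[OF this] have lo: "v - t \<le> c / 2 * u"
    using xy c by (simp add: v_def t_def u_def)
  have hi: "t - v \<le> c / 8 * u"
    using foc_curve_upper_lipschitz[OF x y c(1)] xy by (simp add: v_def t_def u_def)
  note bx = foc_curve_interior_bounds[OF x c(1), folded t_def Q_def]
  note by' = foc_curve_interior_bounds[OF y0 y c(1), folded v_def R_def]
  have cu: "c * u \<le> u / 2" using c u by simp
  have DE: "(D - E) / 2 \<le> u / 8" "(E - D) / 2 \<le> u / 16"
  proof -
    have "c / 2 * u = c * u / 2" "c / 8 * u = c * u / 8" by simp_all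
    then have "D - E \<le> u / 4" "E - D \<le> u / 8"
      using lo hi cu u unfolding v_def t_def by linarith+
    then show "(D - E) / 2 \<le> u / 8" "(E - D) / 2 \<le> u / 16" by simp_all
  qed
  have xE: "x\<^sup>2 / (D * E) \<le> 1"
  proof -
    have "x * x \<le> D * E" using x y xy by (intro mult_mono) auto
    then show ?thesis using x y by (simp add: power2_eq_square)
  qed
  have sq: "y\<^sup>2 / (2 * E) - x\<^sup>2 / (2 * D) = u * ((x + y) / (2 * E)) + (x\<^sup>2 / (D * E)) * ((D - E) / 2)"
    using x y by (simp add: u_def power2_eq_square field_simps)
  have RQ: "R - Q = u - (y\<^sup>2 / (2 * E) - x\<^sup>2 / (2 * D))" by (simp add: R_def Q_def u_def)
  have R_lower: "- u / 8 \<le> R - Q"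
  proof -
    have "u * ((x + y) / (2 * E)) \<le> u * 1"
      using x y xy u by (intro mult_left_mono) auto
    moreover have "(x\<^sup>2 / (D * E)) * ((D - E) / 2) \<le> (x\<^sup>2 / (D * E)) * (u / 8)"
      using x y DE by (intro mult_left_mono) auto
    moreover have "(x\<^sup>2 / (D * E)) * (u / 8) \<le> 1 * (u / 8)"
      using xE u by (intro mult_right_mono) auto
    ultimately show ?thesis unfolding RQ sq by linarith
  qed
  have R_upper: "R - Q \<le> 17 / 16 * u"
  proof -
    have "0 \<le> u * ((x + y) / (2 * E))" using u x y y0 by simp
    moreover have "(x\<^sup>2 / (D * E)) * ((E - D) / 2) \<le> (x\<^sup>2 / (D * E)) * (u / 16)"
      using x y DE by (intro mult_left_mono) auto
    moreover have "(x\<^sup>2 / (D * E)) * (u / 16) \<le> 1 * (u / 16)"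
      using xE u by (intro mult_right_mono) auto
    moreover have "(x\<^sup>2 / (D * E)) * ((D - E) / 2) = - ((x\<^sup>2 / (D * E)) * ((E - D) / 2))"
      by (metis minus_diff_eq minus_divide_left mult_minus_right)
    ultimately show ?thesis unfolding RQ sq by linarith
  qed
  have t: "0 < t" using bx c by simp
  \<comment> \<open>Coefficient of \<open>R - Q\<close> at fixed \<open>t\<close>. The cost changes
    by \<open>R - Q + u\<close>; the share \<open>R - Q\<close> is absorbed here and leaves
    \<open>- t * u\<close>.\<close>
  define K where "K = 2 * (c - t) + t * (Q + R - 1)"
  have QR: "Q + R - 1 \<le> 1 / 2" "- 1 \<le> Q + R - 1" using bx by' c by auto
  have "t * (Q + R - 1) \<le> t * (1 / 2)" "t * (- 1) \<le> t * (Q + R - 1)"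
    using t by (auto intro: mult_left_mono[OF QR(1)] simp only: mult_le_cancel_left_pos QR)
  then have K: "K \<le> t / 2" "- (3 / 2 * t) \<le> K"
    using bx unfolding K_def by auto
  \<comment> \<open>The two signs of \<open>R - Q\<close> give the constants 17/32 and 3/16, both
    below 3/5.\<close>
  have price: "(R - Q) * K \<le> 3 / 5 * (t * u)"
  proof (cases "0 \<le> R - Q")
    case True
    then have "(R - Q) * K \<le> (R - Q) * (t / 2)" using K by (intro mult_left_mono) auto
    also have "\<dots> \<le> 17 / 16 * u * (t / 2)" using R_upper t by (intro mult_right_mono) auto
    also have "\<dots> \<le> 3 / 5 * (t * u)" using t u by simp
    finally show ?thesis .
  next
    case False
    then have "(Q - R) * (- K) \<le> (Q - R) * (3 / 2 * t)" using K by (intro mult_left_mono) auto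
    also have "\<dots> \<le> u / 8 * (3 / 2 * t)" using R_lower t by (intro mult_right_mono) auto
    also have "\<dots> \<le> 3 / 5 * (t * u)" using t u by simp
    finally show ?thesis by (simp add: algebra_simps)
  qed
  \<comment> \<open>Coefficient of \<open>t - v\<close>. It is nonnegative since
    \<open>2 - R \<ge> 5 / 4\<close> and \<open>t + v - 2 * c \<le> c / 2\<close>, so the upper
    bound \<open>hi\<close> on \<open>t - v\<close> suffices.\<close>
  define M where "M = R * (2 - R) + curve_cost c y E - (t + v - 2 * c)"
  have "c * (5 / 4) \<le> R * (2 - R)" using by' c by (intro mult_mono) auto
  then have M0: "0 \<le> M" using bx by' c r unfolding M_def by linarith
  have "R * (2 - R) \<le> 1"
    using zero_le_power2[of "R - 1"] by (simp add: power2_eq_square algebra_simps)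
  then have M2: "M \<le> 2" using bx by' r unfolding M_def by linarith
  have mass: "(t - v) * M \<le> 1 / 4 * (c * u)"
  proof -
    have "(t - v) * M \<le> (c / 8 * u) * M" using hi M0 by (intro mult_right_mono) auto
    also have "\<dots> \<le> (c / 8 * u) * 2" using M2 c u by (intro mult_left_mono) auto
    finally show ?thesis by simp
  qed
  have cost: "curve_cost c x D = Q - (1 - c) + x" "curve_cost c y E = R - (1 - c) + y"
    by (simp_all add: curve_cost_def Q_def R_def)
  have "curve_gap c y E - curve_gap c x D = (R - Q) * K - t * u + (t - v) * M"
    unfolding curve_gap_def Let_def Q_def[symmetric] R_def[symmetric] t_def[symmetric] v_def[symmetric]
      K_def M_def cost u_def
    by (simp add: power2_eq_square algebra_simps)
  also have "\<dots> \<le> - (2 / 5) * (t * u) + 1 / 4 * (c * u)" using price mass by simp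
  also have "\<dots> < 0"
  proof -
    have "c * u \<le> t * u" using bx u by simp
    moreover have "0 < c * u" using c u by simp
    ultimately show ?thesis by linarith
  qed
  finally show ?thesis by simp
qed

section \<open>The corner \<open>p1 = 0\<close> and the advertising revenue\<close>

text \<open>The difference is \<open>x * (r * ((2 * a - x) / 2) - Q * Q)\<close> with
  \<open>Q = p2 + r\<close>. Here \<open>r \<le> Q\<close> as \<open>p2 \<ge> 0\<close>, and
  \<open>(2 * a - x) / 2 \<le> Q\<close> amounts to \<open>2 * a - 1 \<le> x\<close>, which Firm 1's
  inequality yields.\<close>

lemma profit_gap_corner:
  assumes a: "1 / 2 < a" "a < 1" and x: "0 < x" "x \<le> a"
    and foc: "(1 - x) * (4 + x) \<le> 2 * (1 - a) * (2 + x)"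
    and r: "r = curve_cost (1 - a) x x" "0 \<le> r"
  shows "profit1 a r (a - x) 0 - profit2 a r 0 (a - x) (a - x) \<le> 0"
proof -
  have r': "r = 1 - 2 * a + 3 / 2 * x"
    using x by (simp add: r curve_cost_def power2_eq_square)
  have low: "2 * a - 1 \<le> x"
  proof (rule ccontr)
    assume "\<not> 2 * a - 1 \<le> x"
    then have "2 * (1 - a) * (2 + x) < (1 - x) * (4 + x)"
      using a x by (intro mult_strict_mono) auto
    with foc show False by simp
  qed
  define Q where "Q = 1 - a + x / 2"
  have "r * ((2 * a - x) / 2) \<le> r * Q" using low r by (intro mult_left_mono) (auto simp: Q_def)
  also have "\<dots> \<le> Q * Q" using a x r' by (intro mult_right_mono) (auto simp: Q_def)
  finally have "x * (r * ((2 * a - x) / 2) - Q * Q) \<le> 0"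
    using x by (simp add: mult_le_0_iff)
  moreover have "profit1 a r (a - x) 0 - profit2 a r 0 (a - x) (a - x)
      = x * (r * ((2 * a - x) / 2) - Q * Q)"
    unfolding profit1_def profit2_def r' Q_def by (simp add: power2_eq_square field_simps)
  ultimately show ?thesis by simp
qed

text \<open>Positivity makes Firm 1's condition binding: were it slack, \<open>D = x\<close> and
  \<open>profit_gap_corner\<close> would apply.\<close>

lemma positive_profit_gap_interior:
  assumes a: "1 / 2 < a" "a < 1" and r: "0 \<le> r" "r < 1 - a / 2"
    and pos: "prominent_profit a r - nonprominent_profit a r > 0"
  obtains x D where "0 \<le> x" "x \<le> D" "0 < D"
    "(1 - D) * (4 * D + x\<^sup>2) = 2 * (1 - a) * D * (2 + x)" "r = curve_cost (1 - a) x D"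
    "prominent_profit a r - nonprominent_profit a r = curve_gap (1 - a) x D"
proof -
  obtain x D where x: "foc_curve (1 - a) x D" "x \<le> a" "r = curve_cost (1 - a) x D"
    and eq: "eq_prices a r = (D - x, a - x)"
    using eq_prices_curve[OF a r] by blast
  have gap: "prominent_profit a r - nonprominent_profit a r
      = profit1 a r (a - x) (D - x) - profit2 a r (D - x) (a - x) (a - x)"
    by (simp add: prominent_profit_def nonprominent_profit_def eq)
  have "(1 - D) * (4 * D + x\<^sup>2) = 2 * (1 - a) * D * (2 + x)"
  proof (rule ccontr)
    assume "(1 - D) * (4 * D + x\<^sup>2) \<noteq> 2 * (1 - a) * D * (2 + x)"
    with x(1) have D: "D = x" and x0: "0 < x"
      and le: "(1 - x) * (4 * x + x\<^sup>2) \<le> 2 * (1 - a) * x * (2 + x)"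
      by (auto simp: foc_curve_def)
    have "x * ((1 - x) * (4 + x)) \<le> x * (2 * (1 - a) * (2 + x))"
      using le by (simp add: power2_eq_square algebra_simps)
    with x0 have "(1 - x) * (4 + x) \<le> 2 * (1 - a) * (2 + x)" by simp
    from profit_gap_corner[OF a x0 x(2) this x(3)[unfolded D] r(1)] show False
      using pos unfolding gap D by simp
  qed
  with x that gap profit_gap_interior show thesis
    unfolding foc_curve_def by metis
qed

theorem proposition6:
  fixes s a r r' :: real
  assumes "0 < s" and "s < 1 / 8" and "a = 1 - sqrt (2 * s)"
    and "r \<in> {0..rbar a}" and "prominent_profit a r - nonprominent_profit a r > 0"
    and "r' \<in> {0..rbar a}" and "prominent_profit a r' - nonprominent_profit a r' > 0"
    and "r < r'"
  shows "advertising_revenue a r' < advertising_revenue a r"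
proof -
  have "sqrt (2 * s) < 1 / 2" using assms(1,2) by (intro real_less_lsqrt) (auto simp: power2_eq_square)
  then have a: "1 / 2 < a" "a < 1" using assms(1,3) by auto
  have r: "0 \<le> r" "r < 1 - a / 2" "0 \<le> r'" "r' < 1 - a / 2"
    using assms(4,6) rbar_less[OF a] by auto
  obtain x D where x: "0 \<le> x" "x \<le> D" "0 < D"
    "(1 - D) * (4 * D + x\<^sup>2) = 2 * (1 - a) * D * (2 + x)" and rx: "r = curve_cost (1 - a) x D"
    and gx: "prominent_profit a r - nonprominent_profit a r = curve_gap (1 - a) x D"
    using positive_profit_gap_interior[OF a r(1,2) assms(5)] by blast
  obtain y E where y0: "0 \<le> y" and y: "y \<le> E" "0 < E"
    "(1 - E) * (4 * E + y\<^sup>2) = 2 * (1 - a) * E * (2 + y)" and ry: "r' = curve_cost (1 - a) y E"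
    and gy: "prominent_profit a r' - nonprominent_profit a r' = curve_gap (1 - a) y E"
    using positive_profit_gap_interior[OF a r(3,4) assms(7)] by blast
  have curves: "foc_curve (1 - a) x D" "foc_curve (1 - a) y E"
    using x y0 y by (auto simp: foc_curve_def)
  have c: "0 < 1 - a" "1 - a < 1 / 2" "1 - a < 1" using a by auto
  \<comment> \<open>The order of the costs passes to \<open>x\<close> and \<open>y\<close>: equal
    values force equal \<open>D\<close> and equal costs, and \<open>y < x\<close> would reverse the
    costs.\<close>
  have "x < y"
  proof (cases x y rule: linorder_cases)
    case equal
    then have "D = E"
      using foc_curve_lower_lipschitz[OF curves _ c(1)] foc_curve_lower_lipschitz[OF curves(2,1) _ c(1)]
      by simp
    with equal show ?thesis using rx ry \<open>r < r'\<close> by simp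
  next
    case greater
    then show ?thesis
      using curve_cost_strict_mono[OF curves(2,1) greater c(1,3)] rx ry \<open>r < r'\<close> by simp
  qed
  then have "curve_gap (1 - a) y E < curve_gap (1 - a) x D"
    using curve_gap_strict_antimono[OF x y c(1,2)] r a ry by auto
  then show ?thesis
    unfolding advertising_revenue_def max_auction_revenue_eq gx gy .
qed

end
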